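(* Let $f \in \widehat{\mathcal{O}}=\mathbb{C}[[x_1,\ldots,x_n]]$ and let $\delta$ be a singular $\mathbb{C}$-derivation of $\widehat{\mathcal{O}}$ that is logarithmic for $f$, i.e. $\delta(f)\in \langle f\rangle$. Let $\delta=\delta_S+\delta_N$ be the Jordan decomposition of $\delta$ (with $\delta_S$ semisimple, $\delta_N$ topologically nilpotent, both singular, and $[\delta_S,\delta_N]=0$). Then $\delta_S$ and $\delta_N$ are also (singular) logarithmic derivations for $f$, i.e. $\delta_S(f)\in\langle f\rangle$ and $\delta_N(f)\in\langle f\rangle$.
   Context: $\widehat{\mathcal{O}}=\mathbb{C}[[x_1,\ldots,x_n]]$ has maximal ideal $\widehat{\mathfrak{m}}=\langle x_1,\ldots,x_n\rangle$ and is given the $\widehat{\mathfrak{m}}$-adic topology; $\partial_i=\partial/\partial x_i$. A $\mathbb{C}$-derivation $\delta=\sum_i a_i\partial_i$ of $\widehat{\mathcal{O}}$ is singular if all $a_i\in\widehat{\mathfrak{m}}$; equivalently $\delta(\widehat{\mathfrak m}^k)\subseteq\widehat{\mathfrak m}^k$ for all $k$. A singular derivation $\delta$ of $\widehat{\mathcal{O}}$ is semisimple if every closed $\mathbb{C}$-subspace $H\subseteq\widehat{\mathcal{O}}$ stable under $\delta$ admits a supplementary subspace $H'$ ($\widehat{\mathcal{O}}=H\oplus H'$) also stable under $\delta$. It is topologically nilpotent if for every $h\in\widehat{\mathcal{O}}$ the sequence $(\delta^m(h))_m$ tends to $0$ (for every $k$ there is $m_0$ with $\delta^m(h)\in\widehat{\mathfrak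 m}^k$ for all $m\ge m_0$). Jordan decomposition (Gérard–Levelt): every singular derivation $\delta$ of $\widehat{\mathcal{O}}$ can be written uniquely as $\delta=\delta_S+\delta_N$ with $\delta_S,\delta_N$ commuting singular derivations, $\delta_S$ semisimple and $\delta_N$ topologically nilpotent; moreover, there is a regular system of parameters of $\widehat{\mathcal O}$ in which $\delta_S$ is diagonal, i.e. of the form $\sum_i\lambda_ix_i\partial_i$ with $\lambda_i\in\mathbb{C}$, and the matrix of the linear part of $\delta_N$ is nilpotent. *)

theory Defs
  imports Complex_Main "HOL-Library.FuncSet"
begin

section \<open>Formal power series in finitely many variables\<close>

text \<open>
  The variables are indexed by a finite type \<open>'n\<close>, so that \<open>('n, complex) mps\<close> is the ring
  of formal power series over the complex numbers in \<open>n = CARD('n)\<close> variables. A series is its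
  family of coefficients, indexed by the exponent vectors \<open>'n \<Rightarrow> nat\<close>; order and subtraction
  of exponent vectors are pointwise, so \<open>{..m}\<close> below is the set of exponents dividing \<open>m\<close>.
\<close>

typedef (overloaded) ('n, 'a) mps = "UNIV :: (('n::finite \<Rightarrow> nat) \<Rightarrow> 'a::comm_ring_1) set"
  morphisms coeff Abs_mps
  by simp

setup_lifting type_definition_mps

lemma mps_eqI: "(\<And>m. coeff f m = coeff g m) \<Longrightarrow> f = g"
  by transfer auto

lemma finite_atMost_exponent [simp]: "finite {..m :: 'n::finite \<Rightarrow> nat}"
proof (rule finite_subset)
  show "{..m} \<subseteq> PiE UNIV (\<lambda>i. {..m i})"
    by (simp add: subset_iff PiE_iff le_fun_def)
  show "finite (PiE UNIV (\<lambda>i. {..m i}))"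
    by (rule finite_PiE) simp_all
qed

instantiation mps :: (finite, comm_ring_1) comm_ring_1
begin

lift_definition zero_mps :: "('a, 'b) mps" is "\<lambda>_. 0" .
lift_definition one_mps :: "('a, 'b) mps" is "\<lambda>m. if m = (\<lambda>_. 0) then 1 else 0" .
lift_definition plus_mps :: "('a, 'b) mps \<Rightarrow> ('a, 'b) mps \<Rightarrow> ('a, 'b) mps"
  is "\<lambda>f g m. f m + g m" .
lift_definition minus_mps :: "('a, 'b) mps \<Rightarrow> ('a, 'b) mps \<Rightarrow> ('a, 'b) mps"
  is "\<lambda>f g m. f m - g m" .
lift_definition uminus_mps :: "('a, 'b) mps \<Rightarrow> ('a, 'b) mps"
  is "\<lambda>f m. - f m" .
lift_definition times_mps :: "('a, 'b) mps \<Rightarrow> ('a, 'b) mps \<Rightarrow> ('a, 'b) mps"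
  is "\<lambda>f g m. \<Sum>k\<in>{..m}. f k * g (m - k)" .

instance
proof
  fix f g h :: "('a, 'b) mps"
  show "f + g + h = f + (g + h)" "f + g = g + f" "0 + f = f" "- f + f = 0" "f - g = f + - g"
    by (transfer, simp add: algebra_simps)+
  show "(f + g) * h = f * h + g * h"
    by (transfer, simp add: algebra_simps sum.distrib)
  show "(0::('a, 'b) mps) \<noteq> 1"
    by transfer (auto dest: fun_cong[where x = "\<lambda>_. 0"])
  show "f * g = g * f"
  proof (transfer, rule ext)
    fix f g :: "('a \<Rightarrow> nat) \<Rightarrow> 'b" and m
    show "(\<Sum>k\<in>{..m}. f k * g (m - k)) = (\<Sum>k\<in>{..m}. g k * f (m - k))"
      by (rule sum.reindex_bij_witness[where i = "\<lambda>k. m - k" and j = "\<lambda>k. m - k"])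
         (auto simp: le_fun_def fun_eq_iff mult.commute fun_diff_def)
  qed
  show "1 * f = f"
  proof (transfer, rule ext)
    fix f :: "('a \<Rightarrow> nat) \<Rightarrow> 'b" and m
    have "(\<Sum>k\<in>{..m}. (if k = (\<lambda>_. 0) then 1 else 0) * f (m - k)) =
          (\<Sum>k\<in>{..m}. if k = (\<lambda>_. 0) then f (m - k) else 0)"
      by (rule sum.cong) auto
    also have "\<dots> = f (m - (\<lambda>_. 0))"
      by (subst sum.delta) (auto simp: le_fun_def)
    also have "m - (\<lambda>_. 0) = m" by (simp add: fun_diff_def)
    finally show "(\<Sum>k\<in>{..m}. (if k = (\<lambda>_. 0) then 1 else 0) * f (m - k)) = f m" .
  qed
  show "f * g * h = f * (g * h)"
  proof (transfer, rule ext)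
    fix f g h :: "('a \<Rightarrow> nat) \<Rightarrow> 'b" and m
    have "(\<Sum>k\<in>{..m}. (\<Sum>l\<in>{..k}. f l * g (k - l)) * h (m - k)) =
          (\<Sum>(k,l)\<in>(SIGMA k:{..m}. {..k}). f l * g (k - l) * h (m - k))"
      by (simp add: sum_distrib_right sum.Sigma)
    also have "\<dots> = (\<Sum>(k,l)\<in>(SIGMA k:{..m}. {..m - k}). f k * (g l * h (m - k - l)))"
    proof (rule sum.reindex_bij_witness[where i = "\<lambda>(k,l). (\<lambda>i. k i + l i, k)"
                                          and j = "\<lambda>(k,l). (l, k - l)"], goal_cases)
      case (1 a) then show ?case by (auto simp: le_fun_def fun_eq_iff)
    next
      case (2 a)
      then obtain k l where a: "a = (k, l)" "\<And>i. k i \<le> m i" "\<And>i. l i \<le> k i"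
        by (auto simp: le_fun_def)
      have "l i \<le> m i" "k i - l i \<le> m i - l i" for i
        using a(2,3)[of i] by linarith+
      then show ?case by (simp add: a(1) le_fun_def)
    next
      case (3 b) then show ?case by (auto simp: fun_eq_iff)
    next
      case (4 b)
      then obtain k l where b: "b = (k, l)" "\<And>i. k i \<le> m i" "\<And>i. l i \<le> m i - k i"
        by (auto simp: le_fun_def)
      have "k i + l i \<le> m i" for i
        using b(2,3)[of i] by linarith
      then show ?case by (simp add: b(1) le_fun_def)
    next
      case (5 a)
      then obtain k l where a: "a = (k, l)" "\<And>i. k i \<le> m i" "\<And>i. l i \<le> k i"
        by (auto simp: le_fun_def)
      have "m i - l i - (k i - l i) = m i - k i" for i
        using a(2,3)[of i] by linarith
      then have "m - l - (k - l) = m - k"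
        by (simp add: fun_eq_iff)
      then show ?case by (simp add: a(1) mult.assoc)
    qed
    also have "\<dots> = (\<Sum>k\<in>{..m}. f k * (\<Sum>l\<in>{..m - k}. g l * h (m - k - l)))"
      by (simp add: sum_distrib_left sum.Sigma)
    finally show "(\<Sum>k\<in>{..m}. (\<Sum>l\<in>{..k}. f l * g (k - l)) * h (m - k)) =
                  (\<Sum>k\<in>{..m}. f k * (\<Sum>l\<in>{..m - k}. g l * h (m - k - l)))" .
  qed
qed

end

lift_definition mps_scale :: "'a \<Rightarrow> ('n::finite, 'a::comm_ring_1) mps \<Rightarrow> ('n, 'a) mps"
  is "\<lambda>c f m. c * f m" .

lift_definition mps_var :: "'n \<Rightarrow> ('n::finite, 'a::comm_ring_1) mps"
  is "\<lambda>i m. if m = (\<lambda>j. if j = i then 1 else 0) then 1 else 0" .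

lift_definition mps_pderiv ::
    "'n \<Rightarrow> ('n::finite, 'a::comm_ring_1) mps \<Rightarrow> ('n, 'a) mps"
  is "\<lambda>i f m. of_nat (Suc (m i)) * f (m(i := Suc (m i)))" .

text \<open>
  The series as a module over the coefficients (so \<open>mps.subspace\<close> are the linear subspaces),
  and as a module over themselves (so \<open>mps_ideal.span S\<close> is the ideal generated by \<open>S\<close>).
\<close>

global_interpretation mps: module "mps_scale :: 'a \<Rightarrow> ('n::finite, 'a::comm_ring_1) mps \<Rightarrow> _"
  by standard (transfer, simp add: algebra_simps)+

global_interpretation mps_ideal: module "(*) :: ('n::finite, 'a::comm_ring_1) mps \<Rightarrow> _"
  by standard (simp_all add: algebra_simps)


section \<open>The maximal ideal and its adic topology\<close>

definition mps_max_ideal :: "('n::finite, 'a::comm_ring_1) mps set" where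
  "mps_max_ideal = mps_ideal.span (range mps_var)"

primrec mps_max_ideal_power :: "nat \<Rightarrow> ('n::finite, 'a::comm_ring_1) mps set" where
  "mps_max_ideal_power 0 = UNIV"
| "mps_max_ideal_power (Suc k) =
     mps_ideal.span {g * h | g h. g \<in> mps_max_ideal \<and> h \<in> mps_max_ideal_power k}"

lemma subspace_mps_max_ideal_power: "mps_ideal.subspace (mps_max_ideal_power k)"
  by (cases k) (auto simp: mps_ideal.subspace_UNIV)

lemma mps_max_ideal_power_Suc_subset:
  "(mps_max_ideal_power (Suc k) :: ('n::finite, 'a::comm_ring_1) mps set) \<subseteq> mps_max_ideal_power k"
  by (simp, rule mps_ideal.span_minimal)
     (auto intro: mps_ideal.subspace_scale subspace_mps_max_ideal_power)

lemma mps_max_ideal_power_antimono: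
  "k \<le> l \<Longrightarrow> (mps_max_ideal_power l :: ('n::finite, 'a::comm_ring_1) mps set) \<subseteq> mps_max_ideal_power k"
  by (rule lift_Suc_antimono_le[of mps_max_ideal_power]) (rule mps_max_ideal_power_Suc_subset)

instantiation mps :: (finite, comm_ring_1) topological_space
begin

definition open_mps :: "('a, 'b) mps set \<Rightarrow> bool" where
  "open_mps U \<longleftrightarrow> (\<forall>g\<in>U. \<exists>k. \<forall>h. h - g \<in> mps_max_ideal_power k \<longrightarrow> h \<in> U)"

instance
proof
  show "open (UNIV :: ('a, 'b) mps set)" by (simp add: open_mps_def)
next
  fix S T :: "('a, 'b) mps set"
  assume S: "open S" and T: "open T"
  show "open (S \<inter> T)"
    unfolding open_mps_def
  proof
    fix g assume "g \<in> S \<inter> T"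
    then obtain k l where "\<forall>h. h - g \<in> mps_max_ideal_power k \<longrightarrow> h \<in> S"
      "\<forall>h. h - g \<in> mps_max_ideal_power l \<longrightarrow> h \<in> T"
      using S T unfolding open_mps_def by blast
    then have "\<forall>h. h - g \<in> mps_max_ideal_power (max k l) \<longrightarrow> h \<in> S \<inter> T"
      using mps_max_ideal_power_antimono[of k "max k l"] mps_max_ideal_power_antimono[of l "max k l"]
      by (metis IntI max.cobounded1 max.cobounded2 subsetD)
    then show "\<exists>k. \<forall>h. h - g \<in> mps_max_ideal_power k \<longrightarrow> h \<in> S \<inter> T" by blast
  qed
next
  fix K :: "('a, 'b) mps set set"
  assume "\<forall>S\<in>K. open S"
  then show "open (\<Union>K)" unfolding open_mps_def by (meson UnionE UnionI)
qed

end

lemma open_mps_max_ideal_power: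
  "open (mps_max_ideal_power k :: ('n::finite, 'a::comm_ring_1) mps set)"
  unfolding open_mps_def
  using mps_ideal.subspace_add[OF subspace_mps_max_ideal_power] by (metis diff_add_cancel)

lemma tendsto_zero_mps_iff:
  fixes X :: "nat \<Rightarrow> ('n::finite, 'a::comm_ring_1) mps"
  shows "X \<longlonglongrightarrow> 0 \<longleftrightarrow> (\<forall>k. \<exists>m0. \<forall>m\<ge>m0. X m \<in> mps_max_ideal_power k)"
proof
  assume X: "X \<longlonglongrightarrow> 0"
  show "\<forall>k. \<exists>m0. \<forall>m\<ge>m0. X m \<in> mps_max_ideal_power k"
    using topological_tendstoD[OF X open_mps_max_ideal_power]
      mps_ideal.subspace_0[OF subspace_mps_max_ideal_power]
    unfolding eventually_sequentially by blast
next
  assume X: "\<forall>k. \<exists>m0. \<forall>m\<ge>m0. X m \<in> mps_max_ideal_power k"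
  show "X \<longlonglongrightarrow> 0"
  proof (rule topological_tendstoI)
    fix S :: "('n, 'a) mps set" assume "open S" "0 \<in> S"
    then obtain k where k: "\<forall>h. h \<in> mps_max_ideal_power k \<longrightarrow> h \<in> S"
      unfolding open_mps_def by (metis diff_zero)
    with X show "eventually (\<lambda>m. X m \<in> S) sequentially"
      unfolding eventually_sequentially by blast
  qed
qed


section \<open>Singular derivations\<close>

definition mps_derivation ::
    "(('n::finite, 'a::comm_ring_1) mps \<Rightarrow> ('n, 'a) mps) \<Rightarrow> bool" where
  "mps_derivation \<delta> \<longleftrightarrow>
     module_hom mps_scale mps_scale \<delta> \<and> (\<forall>g h. \<delta> (g * h) = \<delta> g * h + g * \<delta> h)"

definition singular_derivation ::
    "(('n::finite, 'a::comm_ring_1) mps \<Rightarrow> ('n, 'a) mps) \<Rightarrow> bool" where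
  "singular_derivation \<delta> \<longleftrightarrow> mps_derivation \<delta> \<and>
     (\<exists>a. (\<forall>i. a i \<in> mps_max_ideal) \<and> (\<forall>h. \<delta> h = (\<Sum>i\<in>UNIV. a i * mps_pderiv i h)))"

definition logarithmic_for ::
    "('n::finite, 'a::comm_ring_1) mps \<Rightarrow> (('n, 'a) mps \<Rightarrow> ('n, 'a) mps) \<Rightarrow> bool" where
  "logarithmic_for f \<delta> \<longleftrightarrow> \<delta> f \<in> mps_ideal.span {f}"

text \<open>The stable supplement \<open>H'\<close> is not required to be closed.\<close>

definition semisimple_derivation ::
    "(('n::finite, 'a::comm_ring_1) mps \<Rightarrow> ('n, 'a) mps) \<Rightarrow> bool" where
  "semisimple_derivation \<delta> \<longleftrightarrow> singular_derivation \<delta> \<and>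
     (\<forall>H. mps.subspace H \<and> closed H \<and> \<delta> ` H \<subseteq> H \<longrightarrow>
        (\<exists>H'. mps.subspace H' \<and> \<delta> ` H' \<subseteq> H' \<and>
              H \<inter> H' = {0} \<and> {h + h' | h h'. h \<in> H \<and> h' \<in> H'} = UNIV))"

definition topologically_nilpotent_derivation ::
    "(('n::finite, 'a::comm_ring_1) mps \<Rightarrow> ('n, 'a) mps) \<Rightarrow> bool" where
  "topologically_nilpotent_derivation \<delta> \<longleftrightarrow> singular_derivation \<delta> \<and>
     (\<forall>h. (\<lambda>m. (\<delta> ^^ m) h) \<longlonglongrightarrow> 0)"

definition jordan_decomposition ::
    "(('n::finite, 'a::comm_ring_1) mps \<Rightarrow> ('n, 'a) mps) \<Rightarrow>
     (('n, 'a) mps \<Rightarrow> ('n, 'a) mps) \<Rightarrow> (('n, 'a) mps \<Rightarrow> ('n, 'a) mps) \<Rightarrow> bool" where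
  "jordan_decomposition \<delta> \<delta>S \<delta>N \<longleftrightarrow>
     singular_derivation \<delta>S \<and> singular_derivation \<delta>N \<and>
     semisimple_derivation \<delta>S \<and> topologically_nilpotent_derivation \<delta>N \<and>
     (\<forall>h. \<delta> h = \<delta>S h + \<delta>N h) \<and> (\<forall>h. \<delta>S (\<delta>N h) = \<delta>N (\<delta>S h))"

end

theory Submission
  imports Defs "HOL-Computational_Algebra.Fundamental_Theorem_Algebra"
    "HOL-Computational_Algebra.Primes"
begin

text \<open>
  Modulo \<open>\<mm>\<^sup>k\<close> the claim is finite-dimensional linear algebra: \<open>W = \<langle>f\<rangle> + \<mm>\<^sup>k\<close> is stable under
  \<open>\<delta>\<close>, and since \<open>\<delta>S\<close> acts diagonally and \<open>\<delta>N\<close> nilpotently modulo \<open>\<mm>\<^sup>k\<close>, the components of an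
  element of \<open>W\<close> in the generalised eigenspaces of \<open>\<delta>\<close>, which are the eigenspaces of \<open>\<delta>S\<close>,
  again lie in \<open>W\<close>. Hence \<open>\<delta>S f \<in> \<langle>f\<rangle> + \<mm>\<^sup>k\<close> for every \<open>k\<close>, and principal ideals are closed. No
  diagonalising coordinates are needed: the span of the eigenvectors of \<open>\<delta>S\<close> modulo \<open>\<mm>\<^sup>k\<close> is
  closed and stable, and a nonzero stable supplement would be finite-dimensional and therefore
  contain a further eigenvector.
\<close>

section \<open>Linear algebra of commuting semisimple and nilpotent maps\<close>

text \<open>The vector \<open>p(T) v\<close>. The scalar multiplication is an argument, so the
  notion also serves \<open>exists_eigenvector\<close>, where the scalar type is algebraically
  closed.\<close>

definition poly_act ::
    "('a::comm_ring_1 \<Rightarrow> 'b::ab_group_add \<Rightarrow> 'b) \<Rightarrow> ('b \<Rightarrow> 'b) \<Rightarrow> 'a poly \<Rightarrow> 'b \<Rightarrow> 'b" where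
  "poly_act scale T p v = (\<Sum>i\<le>degree p. scale (poly.coeff p i) ((T ^^ i) v))"

lemma (in vector_space) poly_act_altdef:
  assumes "degree p \<le> d"
  shows "poly_act scale T p v = (\<Sum>i\<le>d. scale (poly.coeff p i) ((T ^^ i) v))"
  unfolding poly_act_def
  by (rule sum.mono_neutral_left) (use assms in \<open>auto simp: coeff_eq_0\<close>)

text \<open>Multiplication by the indeterminate shifts the coefficients by one, which amounts to one
  more application of \<open>T\<close>.\<close>

lemma (in vector_space) poly_act_linear_factor:
  assumes "module_hom scale scale T"
  shows "poly_act scale T ([:- c, 1:] * p) v = T (poly_act scale T p v) - scale c (poly_act scale T p v)"
proof -
  interpret T: module_hom scale scale T by fact
  let ?d = "degree p"
  have deg: "degree ([:- c, 1:] * p) \<le> Suc ?d"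
    by (rule order.trans[OF degree_mult_le]) simp
  have p: "poly_act scale T p v = (\<Sum>i\<le>Suc ?d. scale (poly.coeff p i) ((T ^^ i) v))"
    by (rule poly_act_altdef) simp
  have "poly_act scale T ([:- c, 1:] * p) v =
      (\<Sum>i\<le>Suc ?d. scale (poly.coeff (pCons 0 p) i) ((T ^^ i) v)) -
      (\<Sum>i\<le>Suc ?d. scale (c * poly.coeff p i) ((T ^^ i) v))"
    by (subst poly_act_altdef[OF deg])
      (simp add: sum_subtractf [symmetric] scale_left_diff_distrib [symmetric] del: sum.atMost_Suc)
  also have "(\<Sum>i\<le>Suc ?d. scale (poly.coeff (pCons 0 p) i) ((T ^^ i) v)) = T (poly_act scale T p v)"
    by (subst sum.atMost_Suc_shift) (simp add: poly_act_def T.sum T.scale)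
  also have "(\<Sum>i\<le>Suc ?d. scale (c * poly.coeff p i) ((T ^^ i) v)) = scale c (poly_act scale T p v)"
    unfolding p scale_sum_right by simp
  finally show ?thesis .
qed

lemma (in vector_space) poly_act_in_subspace:
  assumes "subspace H" "T ` H \<subseteq> H" "v \<in> H"
  shows "poly_act scale T p v \<in> H"
proof -
  have "(T ^^ i) v \<in> H" for i
    using assms(2,3) by (induction i) auto
  with assms(1) show ?thesis
    unfolding poly_act_def by (auto intro: subspace_sum subspace_scale)
qed

text \<open>Finite dimension of \<open>H\<close> is expressed by a linear map \<open>\<pi>\<close>,
  injective on \<open>H\<close>, into a finitely generated span. The orbit of \<open>h\<close> stays
  in \<open>H\<close>, so it cannot be an infinite independent set.\<close>

lemma (in vector_space) exists_annihilating_poly: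
  assumes "subspace H" "T ` H \<subseteq> H" "h \<in> H"
    and "module_hom scale scale \<pi>" "inj_on \<pi> H" "finite B" "\<pi> ` H \<subseteq> span B"
  shows "\<exists>p. p \<noteq> 0 \<and> poly_act scale T p h = 0"
proof (cases "inj (\<lambda>i. (T ^^ i) h)")
  case False
  \<comment> \<open>\<open>dependent\<close> speaks of sets and does not see a repetition in the
    orbit; a repetition is annihilated directly by a difference of two monomials.\<close>
  then obtain i j where ij: "i \<noteq> j" "(T ^^ i) h = (T ^^ j) h"
    by (auto simp: inj_def)
  define p :: "'a poly" where "p = monom 1 i - monom 1 j"
  have "poly.coeff p i = 1"
    using ij(1) by (simp add: p_def)
  then have "p \<noteq> 0" by auto
  have "degree p \<le> max i j"
    unfolding p_def by (rule degree_diff_le) (auto intro: order.trans[OF degree_monom_le])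
  then have "poly_act scale T p h =
      (\<Sum>k\<le>max i j. scale (if i = k then 1 else 0) ((T ^^ k) h)) -
      (\<Sum>k\<le>max i j. scale (if j = k then 1 else 0) ((T ^^ k) h))"
    by (subst poly_act_altdef)
      (auto simp: p_def scale_left_diff_distrib sum_subtractf)
  also have "\<dots> = (T ^^ i) h - (T ^^ j) h"
    by (simp add: if_distrib[where f = "\<lambda>c. scale c _"] cong: if_cong)
  finally show ?thesis using \<open>p \<noteq> 0\<close> ij(2) by auto
next
  case True
  let ?A = "range (\<lambda>i. (T ^^ i) h)"
  have "(T ^^ i) h \<in> H" for i
    using assms(2,3) by (induction i) auto
  then have A: "?A \<subseteq> H" by auto
  have "span ?A \<subseteq> H" by (rule span_minimal[OF A assms(1)])
  interpret \<pi>: module_hom scale scale \<pi> by fact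
  have "dependent ?A"
  proof (rule ccontr)
    assume "independent ?A"
    then have "independent (\<pi> ` ?A)"
      using \<pi>.independent_injective_image assms(5) \<open>span ?A \<subseteq> H\<close> inj_on_subset by blast
    then have "finite (\<pi> ` ?A)"
      using independent_span_bound[OF assms(6)] assms(7) A by blast
    then have "finite ?A"
      by (rule finite_imageD) (rule inj_on_subset[OF assms(5) A])
    then show False using True by (simp add: finite_image_iff)
  qed
  then obtain t u where t: "finite t" "t \<subseteq> ?A" "(\<Sum>v\<in>t. scale (u v) v) = 0" "\<exists>v\<in>t. u v \<noteq> 0"
    unfolding dependent_explicit by blast
  \<comment> \<open>Injectivity of the orbit turns the relation among vectors into one among
    exponents, which supplies the coefficients of \<open>p\<close>.\<close>
  define J where "J = {i. (T ^^ i) h \<in> t}"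
  have inj: "inj_on (\<lambda>i. (T ^^ i) h) J" using True inj_on_subset by blast
  have tJ: "t = (\<lambda>i. (T ^^ i) h) ` J" using t(2) unfolding J_def by auto
  have "finite J" using t(1) inj unfolding tJ by (simp add: finite_image_iff)
  define p where "p = (\<Sum>i\<in>J. monom (u ((T ^^ i) h)) i)"
  have coeff: "poly.coeff p i = (if i \<in> J then u ((T ^^ i) h) else 0)" for i
    using \<open>finite J\<close> by (simp add: p_def coeff_sum)
  obtain d where d: "J \<subseteq> {..d}" using \<open>finite J\<close> finite_nat_iff_bounded_le by blast
  have "degree p \<le> d" by (rule degree_le) (use d coeff in auto)
  then have "poly_act scale T p h = (\<Sum>i\<le>d. scale (poly.coeff p i) ((T ^^ i) h))"
    by (rule poly_act_altdef)
  also have "\<dots> = (\<Sum>i\<in>J. scale (u ((T ^^ i) h)) ((T ^^ i) h))"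
    by (rule sum.mono_neutral_cong_right) (use d coeff in auto)
  also have "\<dots> = 0"
    using t(3) unfolding tJ by (simp add: sum.reindex[OF inj])
  finally have "poly_act scale T p h = 0" .
  moreover have "p \<noteq> 0"
    using t(4) coeff unfolding tJ by (metis (no_types, lifting) coeff_0 imageE)
  ultimately show ?thesis by blast
qed

text \<open>Take an annihilating polynomial \<open>p\<close> of \<open>h\<close> of least degree, a
  root \<open>c\<close> of \<open>p\<close>, and write \<open>p = (X - c) q\<close>. Minimality
  makes \<open>q(T) h\<close> nonzero, and \<open>T - c\<close> kills it.\<close>

lemma exists_eigenvector:
  fixes scale :: "'a::alg_closed_field \<Rightarrow> 'b::ab_group_add \<Rightarrow> 'b"
  assumes "vector_space scale"
    and T: "module_hom scale scale T" and H: "module.subspace scale H" "T ` H \<subseteq> H" "h \<in> H" "h \<noteq> 0"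
    and fin: "module_hom scale scale \<pi>" "inj_on \<pi> H" "finite B" "\<pi> ` H \<subseteq> module.span scale B"
  shows "\<exists>v c. v \<in> H \<and> v \<noteq> 0 \<and> T v = scale c v"
proof -
  interpret vector_space scale by fact
  define P where "P p \<longleftrightarrow> p \<noteq> 0 \<and> poly_act scale T p h = 0" for p
  have "\<exists>p. P p" using exists_annihilating_poly[OF H(1-3) fin] by (simp add: P_def)
  then obtain p where p: "P p" "\<And>q. P q \<Longrightarrow> degree p \<le> degree q"
    using ex_has_least_nat[of P _ degree] by blast
  have "degree p \<noteq> 0"
  proof
    assume "degree p = 0"
    then obtain a where "p = [:a:]" by (rule degree_eq_zeroE)
    with p(1) H(4) show False by (simp add: P_def poly_act_def)
  qed
  then obtain c where "poly p c = 0" using alg_closed_imp_poly_has_root by blast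
  then obtain q where q: "p = [:- c, 1:] * q" by (auto simp: poly_eq_0_iff_dvd)
  have "q \<noteq> 0" using p(1) q by (auto simp: P_def)
  then have "degree q < degree p" unfolding q by (subst degree_mult_eq) auto
  with p(2) have "\<not> P q" by force
  then have "poly_act scale T q h \<noteq> 0" using \<open>q \<noteq> 0\<close> by (simp add: P_def)
  moreover have "T (poly_act scale T q h) = scale c (poly_act scale T q h)"
    using p(1) poly_act_linear_factor[OF T, of c q h] by (simp add: P_def q)
  ultimately show ?thesis using poly_act_in_subspace[OF H(1-3)] by blast
qed

section \<open>Generalised eigenspaces modulo a stable subspace\<close>

text \<open>Modulo \<open>W\<close>, generalised eigenspaces for distinct eigenvalues meet in zero.
  By induction on \<open>a + b\<close>, both \<open>D v - c v\<close> and \<open>D v - d v\<close>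
  lie in \<open>W\<close>, and their difference is \<open>(d - c) v\<close>.\<close>

lemma (in vector_space) mem_subspace_of_two_eigenvalues:
  assumes D: "module_hom scale scale D" and W: "subspace W" "D ` W \<subseteq> W" and "c \<noteq> d"
    and "((\<lambda>x. D x - scale c x) ^^ a) v \<in> W" "((\<lambda>x. D x - scale d x) ^^ b) v \<in> W"
  shows "v \<in> W"
  using assms(5,6)
proof (induction "a + b" arbitrary: a b v rule: less_induct)
  case less
  interpret D: module_hom scale scale D by fact
  show ?case
  proof (cases "a = 0 \<or> b = 0")
    case True
    then show ?thesis using less.prems by auto
  next
    case False
    then obtain a' b' where ab: "a = Suc a'" "b = Suc b'" by (metis not0_implies_Suc)
    have comm: "((\<lambda>x. D x - scale e x) ^^ n) (D x - scale f x) =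
        D (((\<lambda>x. D x - scale e x) ^^ n) x) - scale f (((\<lambda>x. D x - scale e x) ^^ n) x)" for e f n x
      by (induction n) (simp_all add: D.diff D.scale scale_right_diff_distrib mult.commute)
    have stable: "D x - scale e x \<in> W" if "x \<in> W" for x e
      using that W by (auto intro: subspace_diff subspace_scale)
    have "D v - scale c v \<in> W"
      by (rule less.hyps[of a' b])
        (use less.prems stable in \<open>simp_all add: ab(1) comm funpow_Suc_right del: funpow.simps(2)\<close>)
    moreover have "D v - scale d v \<in> W"
      by (rule less.hyps[of a b'])
        (use less.prems stable in \<open>simp_all add: ab(2) comm funpow_Suc_right del: funpow.simps(2)\<close>)
    ultimately have "(D v - scale c v) - (D v - scale d v) \<in> W"
      by (rule subspace_diff[OF W(1)])
    then have "scale (d - c) v \<in> W" by (simp add: scale_left_diff_distrib)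
    then have "scale (inverse (d - c)) (scale (d - c) v) \<in> W" by (rule subspace_scale[OF W(1)])
    then show ?thesis using \<open>c \<noteq> d\<close> by simp
  qed
qed

text \<open>Induction on \<open>\<Lambda>\<close>: a power of \<open>D - d\<close> sends
  \<open>v d\<close> into \<open>W\<close>, so the induction hypothesis puts the images of the other
  components into \<open>W\<close>. Each other \<open>v c\<close> is then a generalised eigenvector
  modulo \<open>W\<close> for both \<open>c\<close> and \<open>d\<close>, hence lies in
  \<open>W\<close>; \<open>v d\<close> follows by subtraction.\<close>

lemma (in vector_space) generalized_eigenvector_components_mem:
  assumes D: "module_hom scale scale D" and W: "subspace W" "D ` W \<subseteq> W"
    and "finite \<Lambda>" and "\<And>c. c \<in> \<Lambda> \<Longrightarrow> \<exists>a. ((\<lambda>x. D x - scale c x) ^^ a) (v c) \<in> W"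
    and "(\<Sum>c\<in>\<Lambda>. v c) \<in> W" "c \<in> \<Lambda>"
  shows "v c \<in> W"
  using assms(4-)
proof (induction \<Lambda> arbitrary: v c rule: finite_induct)
  case (insert d \<Lambda>)
  interpret D: module_hom scale scale D by fact
  let ?T = "\<lambda>c x. D x - scale c x"
  have stable: "(?T e ^^ n) x \<in> W" if "x \<in> W" for x e n
    by (induction n) (use that W in \<open>auto intro: subspace_diff subspace_scale\<close>)
  have comm1: "(?T e ^^ n) (?T f x) = ?T f ((?T e ^^ n) x)" for e f n x
    by (induction n) (simp_all add: D.diff D.scale scale_right_diff_distrib mult.commute)
  have comm: "(?T e ^^ n) ((?T f ^^ m) x) = (?T f ^^ m) ((?T e ^^ n) x)" for e f n m x
    by (induction m) (simp_all add: comm1)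
  have diff: "module_hom scale scale (?T e)" for e
    by unfold_locales (simp_all add: D.add D.scale scale_right_distrib scale_right_diff_distrib mult.commute)
  have hom: "module_hom scale scale (?T e ^^ n)" for e n
  proof (induction n)
    case 0
    show ?case by unfold_locales simp_all
  next
    case (Suc n)
    then show ?case unfolding funpow.simps by (rule module_hom_compose[OF _ diff])
  qed
  obtain a where a: "(?T d ^^ a) (v d) \<in> W" using insert.prems(1) by blast
  interpret Ta: module_hom scale scale "?T d ^^ a" by (rule hom)
  have "(?T d ^^ a) (\<Sum>c\<in>insert d \<Lambda>. v c) \<in> W"
    by (rule stable) (rule insert.prems)
  then have "(?T d ^^ a) (v d) + (\<Sum>c\<in>\<Lambda>. (?T d ^^ a) (v c)) \<in> W"
    using insert.hyps by (simp add: Ta.add Ta.sum)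
  then have sum: "(\<Sum>c\<in>\<Lambda>. (?T d ^^ a) (v c)) \<in> W"
    using subspace_diff[OF W(1) _ a] by fastforce
  have "(?T d ^^ a) (v c) \<in> W" if "c \<in> \<Lambda>" for c
  proof (rule insert.IH[OF _ sum that])
    fix c assume "c \<in> \<Lambda>"
    then obtain b where "(?T c ^^ b) (v c) \<in> W" using insert.prems(1) by blast
    then have "(?T d ^^ a) ((?T c ^^ b) (v c)) \<in> W" by (rule stable)
    then show "\<exists>b. (?T c ^^ b) ((?T d ^^ a) (v c)) \<in> W" by (auto simp: comm)
  qed
  then have rest: "v c \<in> W" if "c \<in> \<Lambda>" for c
    using mem_subspace_of_two_eigenvalues[OF D W, of d c a "v c"] insert.prems(1)[of c] insert.hyps that
    by blast
  then have "(\<Sum>c\<in>\<Lambda>. v c) \<in> W" by (intro subspace_sum[OF W(1)])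
  from subspace_diff[OF W(1) insert.prems(2) this] have "v d \<in> W"
    using insert.hyps by simp
  with rest insert.prems(3) show ?case by auto
qed simp

text \<open>The terms of a linear combination are grouped by eigenvalue: eigenvectors modulo
  \<open>U\<close> for a fixed \<open>c\<close> form a subspace.\<close>

lemma (in vector_space) span_eigenvectors_mod:
  assumes S: "module_hom scale scale S" and U: "subspace U"
    and "x \<in> span {v. \<exists>c. S v - scale c v \<in> U}"
  shows "\<exists>\<Lambda> v. finite \<Lambda> \<and> (\<forall>c. S (v c) - scale c (v c) \<in> U) \<and> x = (\<Sum>c\<in>\<Lambda>. v c)"
  using assms(3)
proof (induction rule: span_induct_alt)
  interpret S: module_hom scale scale S by fact
  case base
  show ?case by (rule exI[of _ "{}"], rule exI[of _ "\<lambda>_. 0"]) (simp add: subspace_0[OF U])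
next
  interpret S: module_hom scale scale S by fact
  case (step e y z)
  then obtain d \<Lambda> v where y: "S y - scale d y \<in> U" and v: "finite \<Lambda>" 
    "\<And>c. S (v c) - scale c (v c) \<in> U" and z: "z = (\<Sum>c\<in>\<Lambda>. v c)" by auto
  \<comment> \<open>Outside \<open>\<Lambda>\<close> the values of \<open>v\<close> do not enter the
    sum \<open>z\<close>, so they are reset to 0 before the new term is added at
    \<open>d\<close>.\<close>
  define w where "w c = (if c \<in> \<Lambda> then v c else 0) + (if c = d then scale e y else 0)" for c
  have "S (scale e y) - scale d (scale e y) \<in> U"
    using subspace_scale[OF U y, of e] by (simp add: S.scale scale_right_diff_distrib mult.commute)
  from subspace_add[OF U v(2)[of d] this] this
  have w: "S (w c) - scale c (w c) \<in> U" for c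
    using v(2) by (auto simp: w_def S.add scale_right_distrib subspace_0[OF U] algebra_simps)
  have "(\<Sum>c\<in>insert d \<Lambda>. w c) = (\<Sum>c\<in>insert d \<Lambda>. if c \<in> \<Lambda> then v c else 0) + scale e y"
    using v(1) by (simp add: w_def sum.distrib del: sum.insert)
  also have "(\<Sum>c\<in>insert d \<Lambda>. if c \<in> \<Lambda> then v c else 0) = z"
    unfolding z by (rule sum.mono_neutral_cong_right) (use v(1) in auto)
  finally have "scale e y + z = (\<Sum>c\<in>insert d \<Lambda>. w c)" by (simp add: add.commute)
  with w v(1) show ?case by blast
qed

text \<open>Split \<open>w\<close> into eigenvectors of \<open>S\<close> modulo \<open>U\<close>. As
  \<open>N\<close> is nilpotent modulo \<open>U\<close>, each is a generalised eigenvector of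
  \<open>S + N\<close> modulo \<open>W\<close>, so it lies in \<open>W\<close>. In the application
  \<open>U\<close> is a power of the maximal ideal and \<open>W\<close> is the ideal generated by
  \<open>f\<close> plus \<open>U\<close>.\<close>

lemma (in vector_space) stable_under_semisimple_part:
  assumes S: "module_hom scale scale S" and N: "module_hom scale scale N"
    and comm: "\<And>x. S (N x) = N (S x)"
    and U: "subspace U" "N ` U \<subseteq> U" and W: "subspace W" "U \<subseteq> W" "\<And>w. w \<in> W \<Longrightarrow> S w + N w \<in> W"
    and nilp: "\<And>x. \<exists>n. (N ^^ n) x \<in> U"
    and diag: "span {v. \<exists>c. S v - scale c v \<in> U} = UNIV"
    and "w \<in> W"
  shows "S w \<in> W"
proof -
  interpret S: module_hom scale scale S by fact
  interpret N: module_hom scale scale N by fact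
  define D where "D x = S x + N x" for x
  have D: "module_hom scale scale D"
    by unfold_locales (simp_all add: D_def S.add N.add S.scale N.scale scale_right_distrib)
  interpret D: module_hom scale scale D by fact
  have DW: "D ` W \<subseteq> W" using W(3) by (auto simp: D_def)
  obtain \<Lambda> v where v: "finite \<Lambda>" "\<And>c. S (v c) - scale c (v c) \<in> U" and w: "w = (\<Sum>c\<in>\<Lambda>. v c)"
    using span_eigenvectors_mod[OF S U(1)] diag by blast
  \<comment> \<open>Induction on the nilpotency exponent: modulo \<open>U\<close>,
    \<open>D - c\<close> maps \<open>y\<close> to \<open>N y\<close>, which is again an eigenvector
    of \<open>S\<close> because \<open>S\<close> and \<open>N\<close> commute.\<close>
  have nilpD: "\<exists>a. ((\<lambda>x. D x - scale c x) ^^ a) y \<in> W" if "S y - scale c y \<in> U" "(N ^^ n) y \<in> U" for y c n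
    using that
  proof (induction n arbitrary: y)
    case 0
    then show ?case using W(2) by (intro exI[of _ 0]) auto
  next
    case (Suc n)
    have "N (S y - scale c y) \<in> U" using Suc.prems(1) U(2) by auto
    then have "S (N y) - scale c (N y) \<in> U" by (simp add: comm N.diff N.scale)
    with Suc obtain a where a: "((\<lambda>x. D x - scale c x) ^^ a) (N y) \<in> W"
      by (auto simp: funpow_Suc_right simp del: funpow.simps(2))
    have stable: "((\<lambda>x. D x - scale c x) ^^ a) x \<in> W" if "x \<in> W" for x
      by (induction a) (use that W(1) DW in \<open>auto intro!: subspace_diff subspace_scale\<close>)
    have add: "((\<lambda>x. D x - scale c x) ^^ a) (x + z) =
        ((\<lambda>x. D x - scale c x) ^^ a) x + ((\<lambda>x. D x - scale c x) ^^ a) z" for x z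
      by (induction a) (simp_all add: D.add scale_right_distrib)
    have "D y - scale c y = (S y - scale c y) + N y" by (simp add: D_def)
    moreover have "((\<lambda>x. D x - scale c x) ^^ a) ((S y - scale c y) + N y) \<in> W"
      unfolding add by (rule subspace_add[OF W(1) _ a], rule stable) (use Suc.prems(1) W(2) in auto)
    ultimately have "((\<lambda>x. D x - scale c x) ^^ Suc a) y \<in> W"
      unfolding funpow_Suc_right comp_apply by (simp only:)
    then show ?case by blast
  qed
  have "v c \<in> W" if "c \<in> \<Lambda>" for c
    by (rule generalized_eigenvector_components_mem[OF D W(1) DW v(1) _ _ that])
      (use nilpD v(2) nilp \<open>w \<in> W\<close> w in blast)+
  \<comment> \<open>On \<open>v c\<close> the map \<open>S\<close> is multiplication by
    \<open>c\<close> up to an element of \<open>U \<subseteq> W\<close>.\<close>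
  then have "S (v c) \<in> W" if "c \<in> \<Lambda>" for c
  proof -
    have "scale c (v c) + (S (v c) - scale c (v c)) \<in> W"
      using W v(2) \<open>\<And>c. c \<in> \<Lambda> \<Longrightarrow> v c \<in> W\<close> that by (intro subspace_add[OF W(1)] subspace_scale) auto
    then show ?thesis by simp
  qed
  then show ?thesis unfolding w S.sum by (intro subspace_sum[OF W(1)])
qed

section \<open>Power series and their order\<close>

hide_const (open) Polynomial.coeff

lemma coeff_mps_mult:
  "coeff (f * g) m = (\<Sum>k\<in>{..m}. coeff f k * coeff g (m - k))"
  by (simp add: times_mps.rep_eq)

lemma coeff_mps_diff [simp]: "coeff (f - g) m = coeff f m - coeff g m"
  by (simp add: minus_mps.rep_eq)

lemma coeff_mps_add [simp]: "coeff (f + g) m = coeff f m + coeff g m"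
  by (simp add: plus_mps.rep_eq)

lemma coeff_mps_zero [simp]: "coeff 0 m = 0"
  by (simp add: zero_mps.rep_eq)

lemma coeff_mps_scale [simp]: "coeff (mps_scale c f) m = c * coeff f m"
  by (simp add: mps_scale.rep_eq)

lemma coeff_Abs_mps [simp]: "coeff (Abs_mps f) = f"
  by (simp add: Abs_mps_inverse)

lemma coeff_mps_sum [simp]: "coeff (\<Sum>i\<in>A. f i) m = (\<Sum>i\<in>A. coeff (f i) m)"
  by (induction A rule: infinite_finite_induct) simp_all

lemma coeff_mps_var_mult:
  "coeff (mps_var i * h) m = (if m i = 0 then 0 else coeff h (m(i := m i - 1)))"
proof -
  let ?e = "\<lambda>j. if j = i then 1 else 0 :: nat"
  have "coeff (mps_var i * h) m = (\<Sum>k\<in>{..m}. if k = ?e then coeff h (m - k) else 0)"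
    unfolding coeff_mps_mult by (rule sum.cong) (auto simp: mps_var.rep_eq)
  also have "\<dots> = (if ?e \<le> m then coeff h (m - ?e) else 0)"
    by (subst sum.delta) auto
  also have "?e \<le> m \<longleftrightarrow> m i \<noteq> 0"
    by (auto simp: le_fun_def)
  also have "m - ?e = m(i := m i - 1)"
    by (auto simp: fun_eq_iff)
  finally show ?thesis by simp
qed

section \<open>Powers of the maximal ideal described by coefficients\<close>

text \<open>\<open>sum m UNIV\<close> is the total degree. By \<open>mps_max_ideal_power_eq\<close>
  this is the \<open>k\<close>-th power of the maximal ideal.\<close>

definition mps_order_ideal :: "nat \<Rightarrow> ('n::finite, 'a::comm_ring_1) mps set" where
  "mps_order_ideal k = {h. \<forall>m. sum m UNIV < k \<longrightarrow> coeff h m = 0}"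

lemma sum_exponent_diff:
  fixes l m :: "'n::finite \<Rightarrow> nat"
  assumes "l \<le> m"
  shows "sum l UNIV + sum (m - l) UNIV = sum m UNIV"
  using assms by (simp add: sum.distrib [symmetric] le_fun_def)

lemma mps_order_ideal_mult:
  assumes "f \<in> mps_order_ideal a" "g \<in> mps_order_ideal b"
  shows "f * g \<in> mps_order_ideal (a + b)"
proof -
  have "coeff (f * g) m = 0" if "sum m UNIV < a + b" for m
    unfolding coeff_mps_mult
  proof (rule sum.neutral, rule ballI)
    fix l assume "l \<in> {..m}"
    then have "sum l UNIV + sum (m - l) UNIV = sum m UNIV"
      by (intro sum_exponent_diff) simp
    then have "sum l UNIV < a \<or> sum (m - l) UNIV < b"
      using that by linarith
    with assms show "coeff f l * coeff g (m - l) = 0"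
      by (auto simp: mps_order_ideal_def)
  qed
  then show ?thesis by (simp add: mps_order_ideal_def)
qed

lemma subspace_mps_order_ideal:
  "mps_ideal.subspace (mps_order_ideal k :: ('n::finite, 'a::comm_ring_1) mps set)"
proof (rule mps_ideal.subspaceI)
  show "c * h \<in> mps_order_ideal k" if "h \<in> mps_order_ideal k" for c h :: "('n, 'a) mps"
    using mps_order_ideal_mult[of c 0 h k] that by (simp add: mps_order_ideal_def)
qed (auto simp: mps_order_ideal_def)

lemma linear_subspace_mps_order_ideal: "mps.subspace (mps_order_ideal k)"
  by (rule mps.subspaceI) (auto simp: mps_order_ideal_def)

lemma mps_max_ideal_subset:
  "mps_max_ideal \<subseteq> (mps_order_ideal 1 :: ('n::finite, 'a::comm_ring_1) mps set)"
  unfolding mps_max_ideal_def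
proof (rule mps_ideal.span_minimal[OF _ subspace_mps_order_ideal], rule image_subsetI)
  show "mps_var i \<in> (mps_order_ideal 1 :: ('n, 'a) mps set)" for i
    by (auto simp: mps_order_ideal_def mps_var.rep_eq)
qed

text \<open>One inclusion is additivity of orders under products. For the other, each monomial of
  positive degree is divided by one chosen variable, which writes \<open>h\<close> as a combination
  of the variables with cofactors of order one less.\<close>

lemma mps_max_ideal_power_eq:
  "mps_max_ideal_power k = (mps_order_ideal k :: ('n::finite, 'a::comm_ring_1) mps set)"
proof (induction k)
  case 0
  show ?case by (simp add: mps_order_ideal_def)
next
  case (Suc k)
  show ?case
  proof
    show "mps_max_ideal_power (Suc k) \<subseteq> (mps_order_ideal (Suc k) :: ('n, 'a) mps set)"
      unfolding mps_max_ideal_power.simps Suc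
    proof (rule mps_ideal.span_minimal[OF _ subspace_mps_order_ideal])
      show "{g * h | g h. g \<in> mps_max_ideal \<and> h \<in> mps_order_ideal k} \<subseteq>
          (mps_order_ideal (Suc k) :: ('n, 'a) mps set)"
        using mps_order_ideal_mult[of _ 1 _ k] mps_max_ideal_subset by auto
    qed
  next
    show "mps_order_ideal (Suc k) \<subseteq> (mps_max_ideal_power (Suc k) :: ('n, 'a) mps set)"
    proof
      fix h :: "('n, 'a) mps" assume h: "h \<in> mps_order_ideal (Suc k)"
      \<comment> \<open>\<open>c m\<close> chooses a variable dividing the monomial
        \<open>m\<close>, and \<open>q i\<close> collects the monomials assigned to
        \<open>i\<close>, divided by that variable. At \<open>m = 0\<close> the choice is arbitrary
        but harmless, since \<open>h\<close> has no constant term.\<close>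
      define c :: "('n \<Rightarrow> nat) \<Rightarrow> 'n" where "c m = (SOME i. m i \<noteq> 0)" for m
      define q where "q i = Abs_mps (\<lambda>m. if c (m(i := Suc (m i))) = i
        then coeff h (m(i := Suc (m i))) else 0)" for i
      have "h = (\<Sum>i\<in>UNIV. mps_var i * q i)"
      proof (rule mps_eqI)
        fix m
        have "coeff (mps_var i * q i) m = (if i = c m then if m i = 0 then 0 else coeff h m else 0)" for i
        proof (cases "m i = 0")
          case False
          then have "m(i := Suc (m i - 1)) = m" by auto
          with False show ?thesis by (auto simp: coeff_mps_var_mult q_def)
        qed (auto simp: coeff_mps_var_mult)
        then have "coeff (\<Sum>i\<in>UNIV. mps_var i * q i) m =
            (\<Sum>i\<in>UNIV. if i = c m then if m i = 0 then 0 else coeff h m else 0)"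
          by simp
        also have "\<dots> = (if m (c m) = 0 then 0 else coeff h m)"
          by simp
        also have "\<dots> = coeff h m"
        proof (cases "\<exists>i. m i \<noteq> 0")
          case True
          then have "m (c m) \<noteq> 0" unfolding c_def by (rule someI_ex)
          then show ?thesis by simp
        next
          case False
          then show ?thesis using h by (simp add: mps_order_ideal_def)
        qed
        finally show "coeff h m = coeff (\<Sum>i\<in>UNIV. mps_var i * q i) m" ..
      qed
      moreover have "q i \<in> mps_max_ideal_power k" for i
      proof -
        have "coeff (q i) m = 0" if "sum m UNIV < k" for m
        proof -
          have "sum (m(i := Suc (m i))) UNIV = Suc (sum m UNIV)"
            by (simp add: sum.remove[of UNIV i])
          with that h show ?thesis by (simp add: q_def mps_order_ideal_def)
        qed
        then show ?thesis by (simp add: Suc mps_order_ideal_def)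
      qed
      moreover have "mps_var i \<in> (mps_max_ideal :: ('n, 'a) mps set)" for i
        unfolding mps_max_ideal_def by (rule mps_ideal.span_base) simp
      ultimately show "h \<in> mps_max_ideal_power (Suc k)"
        unfolding mps_max_ideal_power.simps
        by (metis (mono_tags, lifting) mem_Collect_eq mps_ideal.span_base mps_ideal.span_sum)
    qed
  qed
qed

text \<open>A linear map with kernel \<open>mps_order_ideal k\<close> and finite-dimensional image,
  standing in for the quotient map modulo that ideal.\<close>

definition mps_truncate :: "nat \<Rightarrow> ('n::finite, 'a::comm_ring_1) mps \<Rightarrow> ('n, 'a) mps" where
  "mps_truncate k h = Abs_mps (\<lambda>m. if sum m UNIV < k then coeff h m else 0)"

lemma module_hom_mps_truncate: "module_hom mps_scale mps_scale (mps_truncate k)"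
  by unfold_locales (auto simp: mps_truncate_def intro!: mps_eqI)

lemma mps_truncate_eq_iff: "mps_truncate k g = mps_truncate k h \<longleftrightarrow> g - h \<in> mps_order_ideal k"
  by (auto simp: mps_truncate_def mps_order_ideal_def Abs_mps_inject fun_eq_iff)

lemma mps_truncate_finite_span:
  "\<exists>B. finite B \<and> range (mps_truncate k) \<subseteq> mps.span (B :: ('n::finite, 'a::comm_ring_1) mps set)"
proof (intro exI conjI)
  let ?M = "{m :: 'n \<Rightarrow> nat. sum m UNIV < k}"
  let ?e = "\<lambda>m. Abs_mps (\<lambda>l. if l = m then 1 else 0) :: ('n, 'a) mps"
  have "m \<in> {..(\<lambda>_. k)}" if "sum m UNIV < k" for m :: "'n \<Rightarrow> nat"
    using that member_le_sum[of _ UNIV m] by (auto simp: le_fun_def intro: order.trans less_imp_le)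
  then have fin: "finite ?M"
    by (intro finite_subset[OF _ finite_atMost_exponent]) auto
  then show "finite (?e ` ?M)" by simp
  show "range (mps_truncate k) \<subseteq> mps.span (?e ` ?M)"
  proof (rule image_subsetI)
    fix h :: "('n, 'a) mps"
    have "mps_truncate k h = (\<Sum>m\<in>?M. mps_scale (coeff h m) (?e m))"
      by (rule mps_eqI) (simp add: mps_truncate_def fin if_distrib[where f = "(*) _"] cong: if_cong)
    also have "\<dots> \<in> mps.span (?e ` ?M)"
      by (intro mps.span_sum mps.span_scale mps.span_base imageI)
    finally show "mps_truncate k h \<in> mps.span (?e ` ?M)" .
  qed
qed

section \<open>Closedness of principal ideals\<close>

text \<open>
  The product of prime powers \<open>\<Prod>\<^sub>i p\<^sub>i ^ m\<^sub>i\<close> is a monomial order of type \<open>\<omega>\<close> on the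
  exponents, for which no order on the index type is needed.
\<close>

lemma exists_multiplicative_weight:
  "\<exists>v :: ('n::finite \<Rightarrow> nat) \<Rightarrow> nat.
     inj v \<and> (\<forall>l m. l \<le> m \<longrightarrow> v l * v (m - l) = v m) \<and> (\<forall>m. sum m UNIV < v m)"
proof -
  obtain e :: "nat \<Rightarrow> nat" where e: "inj e" "range e \<subseteq> {p. prime p}"
    using infinite_countable_subset[OF primes_infinite] by blast
  obtain t :: "'n \<Rightarrow> nat" where t: "inj t"
    using finite_imp_inj_to_nat_seg[OF finite_UNIV] by blast
  define p where "p = e \<circ> t"
  have inj: "inj p" unfolding p_def by (rule inj_compose[OF e(1) t])
  have prime: "prime (p i)" for i using e(2) by (auto simp: p_def)
  define v where "v m = (\<Prod>i\<in>UNIV. p i ^ m i)" for m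
  have "m = l" if "v m = v l" for m l
  proof
    fix i
    \<comment> \<open>Unique factorisation recovers the exponents; the product is reindexed by the
      primes themselves for this.\<close>
    have "multiplicity (p i) (v m) = m i" for m
    proof -
      have "v m = (\<Prod>q\<in>range p. q ^ m (inv p q))"
        by (simp add: v_def prod.reindex[OF inj] inj)
      also have "multiplicity (p i) \<dots> = m (inv p (p i))"
        by (subst multiplicity_prod_prime_powers) (use prime in auto)
      finally show ?thesis using inj by simp
    qed
    with that show "m i = l i" by metis
  qed
  then have "inj v" by (rule injI)
  moreover have "v l * v (m - l) = v m" if "l \<le> m" for l m
    using that by (simp add: v_def prod.distrib [symmetric] power_add [symmetric] le_fun_def)
  moreover have "sum m UNIV < v m" for m
  proof -
    have "sum m UNIV < 2 ^ sum m UNIV" by (rule less_exp)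
    also have "\<dots> = (\<Prod>i\<in>UNIV. 2 ^ m i)" by (simp add: power_sum)
    also have "\<dots> \<le> v m"
      unfolding v_def by (intro prod_mono) (use prime prime_ge_2_nat in \<open>auto intro: power_mono\<close>)
    finally show ?thesis .
  qed
  ultimately show ?thesis by blast
qed

text \<open>The approximate quotients converge: if \<open>f * q\<close> vanishes up to a large
  weight, so does \<open>q\<close> up to a proportionally smaller one. Their coefficientwise limit
  is an exact quotient.\<close>

lemma mps_principal_ideal_closed:
  fixes f g :: "('n::finite, 'a::idom) mps"
  assumes "\<And>k. \<exists>q. g - f * q \<in> mps_order_ideal k"
  shows "\<exists>q. g = f * q"
proof (cases "f = 0")
  case True
  have "coeff g m = 0" for m
    using assms[of "Suc (sum m UNIV)"] True by (auto simp: mps_order_ideal_def)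
  then have "g = f * 0" by (auto intro: mps_eqI)
  then show ?thesis ..
next
  case False
  obtain v :: "('n \<Rightarrow> nat) \<Rightarrow> nat" where v: "inj v"
    "\<And>l m. l \<le> m \<Longrightarrow> v l * v (m - l) = v m" "\<And>m. sum m UNIV < v m"
    using exists_multiplicative_weight by blast
  have pos: "v m > 0" for m using v(3)[of m] by simp
  have leading: "\<exists>m. coeff h m \<noteq> 0 \<and> (\<forall>l. coeff h l \<noteq> 0 \<longrightarrow> v m \<le> v l)" if h: "h \<noteq> 0"
    for h :: "('n, 'a) mps"
  proof -
    have "\<exists>m. coeff h m \<noteq> 0" using h by (metis coeff_mps_zero mps_eqI)
    then show ?thesis using ex_has_least_nat[of "\<lambda>m. coeff h m \<noteq> 0" _ v] by blast
  qed
  obtain mf where mf: "coeff f mf \<noteq> 0" "\<And>l. coeff f l \<noteq> 0 \<Longrightarrow> v mf \<le> v l"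
    using leading[OF False] by blast
  \<comment> \<open>Otherwise the lowest terms of \<open>f\<close> and \<open>q\<close> multiply to
    a nonzero term of \<open>f * q\<close>, of weight \<open>v mf * v mq < D * v mf\<close>.\<close>
  have vanish: "coeff q m = 0"
    if q: "\<And>l. v l < D * v mf \<Longrightarrow> coeff (f * q) l = 0" and "v m < D" for q D m
  proof (rule ccontr)
    assume m: "coeff q m \<noteq> 0"
    then have "q \<noteq> 0" by auto
    then obtain mq where mq: "coeff q mq \<noteq> 0" "\<And>l. coeff q l \<noteq> 0 \<Longrightarrow> v mq \<le> v l"
      using leading by blast
    define s where "s i = mf i + mq i" for i
    have s: "mf \<le> s" "s - mf = mq" by (auto simp: s_def le_fun_def fun_eq_iff)
    have vs: "v s = v mf * v mq" using v(2)[OF s(1)] s(2) by simp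
    \<comment> \<open>No other pair contributes at \<open>s\<close>: two nonzero factors have
      weights at least \<open>v mf\<close> and \<open>v mq\<close> with product
      \<open>v mf * v mq\<close>, so \<open>v l = v mf\<close>, and \<open>v\<close> is
      injective.\<close>
    have "coeff f l * coeff q (s - l) = (if l = mf then coeff f mf * coeff q mq else 0)"
      if "l \<le> s" for l
    proof (cases "coeff f l = 0 \<or> coeff q (s - l) = 0")
      case True
      then show ?thesis using mf(1) mq(1) s(2) by auto
    next
      case False
      then have le: "v mf \<le> v l" "v mq \<le> v (s - l)" using mf(2) mq(2) by auto
      have "v l * v (s - l) = v mf * v mq" using v(2)[OF that] vs by simp
      moreover have "v mf * v mq < v l * v (s - l)" if "v mf < v l"
        using mult_less_le_imp_less[OF that le(2)] pos by simp
      ultimately have "v l = v mf" using le(1) by linarith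
      then show ?thesis using v(1) s(2) by (auto dest: injD)
    qed
    then have "coeff (f * q) s = (\<Sum>l\<in>{..s}. if l = mf then coeff f mf * coeff q mq else 0)"
      unfolding coeff_mps_mult by (intro sum.cong) auto
    also have "\<dots> = coeff f mf * coeff q mq" using s(1) by simp
    also have "\<dots> \<noteq> 0" using mf(1) mq(1) by simp
    finally have "coeff (f * q) s \<noteq> 0" .
    moreover have "v mq < D" using mq(2)[OF m] \<open>v m < D\<close> by simp
    then have "v s < D * v mf" unfolding vs using pos[of mf] by (simp add: mult.commute)
    ultimately show False using q by blast
  qed
  obtain Q where Q: "\<And>k. g - f * Q k \<in> mps_order_ideal k" using assms by metis
  \<comment> \<open>The weight exceeds the total degree, so a congruence modulo
    \<open>mps_order_ideal k\<close> fixes all coefficients of weight below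
    \<open>k\<close>.\<close>
  have fQ: "coeff (f * Q k) m = coeff g m" if "v m < k" for k m
    using Q[of k] v(3)[of m] that by (auto simp: mps_order_ideal_def)
  have stationary: "coeff (Q k) m = coeff (Q k') m"
    if "v m < D" "D * v mf \<le> k" "D * v mf \<le> k'" for m D k k'
  proof -
    have "coeff (Q k - Q k') m = 0"
      by (rule vanish[OF _ that(1)]) (use that fQ in \<open>simp add: right_diff_distrib\<close>)
    then show ?thesis by simp
  qed
  \<comment> \<open>The index is the threshold of \<open>stationary\<close> for
    \<open>D = Suc (v m)\<close>; the successor is there because \<open>v m < D\<close> is
    strict.\<close>
  define q where "q = Abs_mps (\<lambda>m. coeff (Q (Suc (v m) * v mf)) m)"
  have "coeff (f * q) m = coeff g m" for m
  proof -
    let ?k = "Suc (v m) * v mf"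
    have "coeff (f * q) m = coeff (f * Q ?k) m"
      unfolding coeff_mps_mult
    proof (rule sum.cong[OF refl])
      fix l assume "l \<in> {..m}"
      then have "v l * v (m - l) = v m" using v(2) by simp
      \<comment> \<open>Divisors of \<open>m\<close> have no larger weight, so the single index
        \<open>?k\<close> serves every coefficient of \<open>q\<close> in the convolution.\<close>
      then have "v (m - l) \<le> v m" using pos[of l] by (metis Suc_leI mult_1 mult_le_mono1 One_nat_def)
      then have "coeff q (m - l) = coeff (Q ?k) (m - l)"
        unfolding q_def coeff_Abs_mps by (intro stationary[of _ "Suc (v (m - l))"] mult_le_mono) auto
      then show "coeff f l * coeff q (m - l) = coeff f l * coeff (Q ?k) (m - l)" by simp
    qed
    also have "\<dots> = coeff g m"
    proof (rule fQ)
      have "Suc (v m) * 1 \<le> ?k" by (rule mult_le_mono2) (use pos[of mf] in simp)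
      then show "v m < ?k" by simp
    qed
    finally show ?thesis .
  qed
  then have "g = f * q" by (auto intro: mps_eqI)
  then show ?thesis ..
qed

section \<open>Singular derivations modulo powers of the maximal ideal\<close>

lemma vector_space_mps: "vector_space (mps_scale :: 'a::field \<Rightarrow> ('n::finite, 'a) mps \<Rightarrow> _)"
  by unfold_locales (simp_all add: mps.scale_right_distrib mps.scale_left_distrib)

lemma singular_derivation_module_hom:
  "singular_derivation \<delta> \<Longrightarrow> module_hom mps_scale mps_scale \<delta>"
  by (simp add: singular_derivation_def mps_derivation_def)

text \<open>A partial derivative lowers the order by at most one, and its coefficient in the maximal
  ideal restores the loss.\<close>

lemma singular_derivation_mps_order_ideal:
  fixes \<delta> :: "('n::finite, 'a::comm_ring_1) mps \<Rightarrow> ('n, 'a) mps"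
  assumes "singular_derivation \<delta>" "h \<in> mps_order_ideal k"
  shows "\<delta> h \<in> mps_order_ideal k"
proof (cases k)
  case 0
  then show ?thesis by (simp add: mps_order_ideal_def)
next
  case (Suc d)
  obtain a where a: "\<And>i. a i \<in> mps_max_ideal" "\<delta> h = (\<Sum>i\<in>UNIV. a i * mps_pderiv i h)"
    using assms(1) unfolding singular_derivation_def by blast
  have "mps_pderiv i h \<in> mps_order_ideal d" for i
  proof -
    have "sum (m(i := Suc (m i))) UNIV = Suc (sum m UNIV)" for m :: "'n \<Rightarrow> nat"
      by (simp add: sum.remove[of UNIV i])
    then show ?thesis using assms(2) by (simp add: mps_order_ideal_def mps_pderiv.rep_eq Suc)
  qed
  then have "a i * mps_pderiv i h \<in> mps_order_ideal (1 + d)" for i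
    using a(1) mps_max_ideal_subset by (intro mps_order_ideal_mult) auto
  then show ?thesis
    unfolding a(2) Suc by (intro mps_ideal.subspace_sum[OF subspace_mps_order_ideal]) simp
qed

text \<open>\<open>H\<close> is a union of cosets of the open subspace
  \<open>mps_order_ideal k\<close>, and so is its complement.\<close>

lemma closed_mps_if_order_ideal_subset:
  assumes "mps.subspace H" "mps_order_ideal k \<subseteq> H"
  shows "closed H"
  unfolding closed_def open_mps_def
proof (intro ballI exI allI impI)
  fix g h assume "g \<in> - H" "h - g \<in> mps_max_ideal_power k"
  then have "h - g \<in> H" using assms(2) by (auto simp: mps_max_ideal_power_eq)
  then have "h - (h - g) \<in> H" if "h \<in> H" using mps.subspace_diff[OF assms(1) that] by blast
  then show "h \<in> - H" using \<open>g \<in> - H\<close> by auto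
qed

section \<open>Diagonalisability and the logarithmic condition modulo a power of the maximal
  ideal\<close>

lemma semisimple_span_eigenvectors:
  fixes \<delta> :: "('n::finite, 'a::alg_closed_field) mps \<Rightarrow> ('n, 'a) mps"
  assumes "semisimple_derivation \<delta>"
  shows "mps.span {h. \<exists>c. \<delta> h - mps_scale c h \<in> mps_order_ideal k} = UNIV"
proof -
  let ?A = "{h. \<exists>c. \<delta> h - mps_scale c h \<in> mps_order_ideal k}"
  let ?E = "mps.span ?A"
  have sing: "singular_derivation \<delta>" using assms by (simp add: semisimple_derivation_def)
  have hom: "module_hom mps_scale mps_scale \<delta>" by (rule singular_derivation_module_hom[OF sing])
  interpret \<delta>: module_hom mps_scale mps_scale \<delta> by (rule hom)
  have E: "mps.subspace ?E" by (rule mps.subspace_span)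
  \<comment> \<open>Since \<open>\<delta>\<close> preserves this ideal, its elements are
    eigenvectors modulo it for \<open>c = 0\<close>.\<close>
  have "mps_order_ideal k \<subseteq> ?A"
    using singular_derivation_mps_order_ideal[OF sing] by (auto intro!: exI[of _ 0])
  then have UE: "mps_order_ideal k \<subseteq> ?E" using mps.span_superset by blast
  have "\<delta> h \<in> ?E" if h: "h \<in> ?A" for h
  proof -
    from h obtain c where "\<delta> h - mps_scale c h \<in> ?E" using UE by blast
    moreover have "mps_scale c h \<in> ?E" by (rule mps.span_scale, rule mps.span_base, rule h)
    ultimately have "(\<delta> h - mps_scale c h) + mps_scale c h \<in> ?E" by (rule mps.span_add)
    then show ?thesis by simp
  qed
  then have "mps.span (\<delta> ` ?A) \<subseteq> ?E" by (intro mps.span_minimal[OF _ E]) auto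
  then have "\<delta> ` ?E \<subseteq> ?E" by (simp add: \<delta>.span_image)
  then obtain H where H: "mps.subspace H" "\<delta> ` H \<subseteq> H" "?E \<inter> H = {0}"
    "{h + h' | h h'. h \<in> ?E \<and> h' \<in> H} = UNIV"
    using assms E closed_mps_if_order_ideal_subset[OF E UE]
    unfolding semisimple_derivation_def by blast
  obtain B :: "('n, 'a) mps set" where B: "finite B" "range (mps_truncate k) \<subseteq> mps.span B"
    using mps_truncate_finite_span by blast
  \<comment> \<open>The kernel of the truncation lies in \<open>?E\<close>, which meets
    \<open>H\<close> only in 0; so \<open>H\<close> is finite-dimensional.\<close>
  have inj: "inj_on (mps_truncate k) H"
  proof (rule inj_onI)
    fix g h assume "g \<in> H" "h \<in> H" "mps_truncate k g = mps_truncate k h"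
    then have "g - h \<in> ?E \<inter> H"
      using UE mps.subspace_diff[OF H(1)] by (auto simp: mps_truncate_eq_iff)
    then show "g = h" using H(3) by auto
  qed
  have "h = 0" if h: "h \<in> H" for h
  proof (rule ccontr)
    assume "h \<noteq> 0"
    then obtain g c where g: "g \<in> H" "g \<noteq> 0" "\<delta> g = mps_scale c g"
      using exists_eigenvector[OF vector_space_mps hom H(1,2) h _ module_hom_mps_truncate inj B(1)] B(2)
      by blast
    \<comment> \<open>An exact eigenvector is in particular one modulo the ideal.\<close>
    then have "g \<in> ?A"
      by (auto intro!: exI[of _ c] mps_ideal.subspace_0[OF subspace_mps_order_ideal])
    then have "g \<in> ?E \<inter> H" using g(1) by (auto intro: mps.span_base)
    then show False using H(3) g(2) by auto
  qed
  then have "{h + h' | h h'. h \<in> ?E \<and> h' \<in> H} \<subseteq> ?E" by force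
  with H(4) show ?thesis by blast
qed

lemma jordan_semisimple_part_mod_order_ideal:
  fixes f :: "('n::finite, 'a::alg_closed_field) mps"
  assumes \<delta>: "singular_derivation \<delta>" "logarithmic_for f \<delta>" and J: "jordan_decomposition \<delta> \<delta>S \<delta>N"
  shows "\<exists>q. \<delta>S f - f * q \<in> mps_order_ideal k"
proof -
  interpret vector_space "mps_scale :: 'a \<Rightarrow> ('n, 'a) mps \<Rightarrow> _" by (rule vector_space_mps)
  let ?U = "mps_order_ideal k :: ('n, 'a) mps set"
  define W where "W = {h. \<exists>q. h - f * q \<in> ?U}"
  have U: "mps.subspace ?U" by (rule linear_subspace_mps_order_ideal)
  have sing: "singular_derivation \<delta>S" "singular_derivation \<delta>N" "semisimple_derivation \<delta>S"
    and nil: "topologically_nilpotent_derivation \<delta>N"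
    and sum: "\<delta> h = \<delta>S h + \<delta>N h" and comm: "\<delta>S (\<delta>N h) = \<delta>N (\<delta>S h)" for h
    using J unfolding jordan_decomposition_def by blast+
  interpret \<delta>: module_hom mps_scale mps_scale \<delta> by (rule singular_derivation_module_hom[OF \<delta>(1)])
  have W: "mps.subspace W"
  proof (rule mps.subspaceI)
    show "0 \<in> W" using mps.subspace_0[OF U] by (auto simp: W_def intro!: exI[of _ 0])
    show "g + h \<in> W" if "g \<in> W" "h \<in> W" for g h
    proof -
      from that obtain p q where "g - f * p \<in> ?U" "h - f * q \<in> ?U" by (auto simp: W_def)
      then have "(g - f * p) + (h - f * q) \<in> ?U" by (rule mps.subspace_add[OF U])
      then have "(g + h) - f * (p + q) \<in> ?U" by (simp add: algebra_simps)
      then show ?thesis by (auto simp: W_def)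
    qed
    show "mps_scale c h \<in> W" if "h \<in> W" for c h
    proof -
      from that obtain q where "h - f * q \<in> ?U" by (auto simp: W_def)
      then have "mps_scale c (h - f * q) \<in> ?U" by (rule mps.subspace_scale[OF U])
      also have "mps_scale c (h - f * q) = mps_scale c h - f * mps_scale c q"
        by (rule mps_eqI)
          (simp add: coeff_mps_mult right_diff_distrib sum_distrib_left mult.left_commute)
      finally show ?thesis by (auto simp: W_def)
    qed
  qed
  have UW: "?U \<subseteq> W" by (auto simp: W_def intro!: exI[of _ 0])
  obtain r where r: "\<delta> f = r * f"
    using \<delta>(2) by (auto simp: logarithmic_for_def mps_ideal.span_singleton)
  have stable: "\<delta>S h + \<delta>N h \<in> W" if "h \<in> W" for h
  proof -
    from that obtain q where "h - f * q \<in> ?U" by (auto simp: W_def)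
    then have "\<delta> (h - f * q) \<in> ?U" by (rule singular_derivation_mps_order_ideal[OF \<delta>(1)])
    \<comment> \<open>By the Leibniz rule and \<open>\<delta> f = r * f\<close>, multiples of
      \<open>f\<close> go to multiples of \<open>f\<close>.\<close>
    moreover have "\<delta> (f * q) = \<delta> f * q + f * \<delta> q"
      using \<delta>(1) unfolding singular_derivation_def mps_derivation_def by blast
    then have "\<delta> (f * q) = f * (r * q + \<delta> q)"
      unfolding r by (simp only: distrib_left mult_ac)
    ultimately have "\<delta> h - f * (r * q + \<delta> q) \<in> ?U" by (simp add: \<delta>.diff)
    then show ?thesis unfolding W_def sum [symmetric] by blast
  qed
  have "\<delta>S f \<in> W"
  proof (rule stable_under_semisimple_part[OF _ _ comm U _ W UW stable])
    show "module_hom mps_scale mps_scale \<delta>S" "module_hom mps_scale mps_scale \<delta>N"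
      using sing singular_derivation_module_hom by auto
    show "\<delta>N ` ?U \<subseteq> ?U" using singular_derivation_mps_order_ideal[OF sing(2)] by auto
    \<comment> \<open>Convergence to 0 in the adic topology becomes nilpotency, element by element,
      modulo the ideal.\<close>
    show "\<exists>n. (\<delta>N ^^ n) h \<in> ?U" for h
      using nil unfolding topologically_nilpotent_derivation_def tendsto_zero_mps_iff
        mps_max_ideal_power_eq by blast
    show "mps.span {h. \<exists>c. \<delta>S h - mps_scale c h \<in> ?U} = UNIV"
      by (rule semisimple_span_eigenvectors[OF sing(3)])
    show "f \<in> W" using mps.subspace_0[OF U] by (auto simp: W_def intro!: exI[of _ 1])
  qed
  then show ?thesis by (simp add: W_def)
qed

theorem proposition3p2:
  fixes f :: "('n::finite, complex) mps"
    and \<delta> \<delta>S \<delta>N :: "('n, complex) mps \<Rightarrow> ('n, complex) mps"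
  assumes "singular_derivation \<delta>"
    and "logarithmic_for f \<delta>"
    and "jordan_decomposition \<delta> \<delta>S \<delta>N"
  shows "singular_derivation \<delta>S \<and> logarithmic_for f \<delta>S \<and>
         singular_derivation \<delta>N \<and> logarithmic_for f \<delta>N"
proof -
  \<comment> \<open>The quotient found modulo each power depends on that power; closedness of the
    principal ideal replaces them by a single one.\<close>
  obtain q where "\<delta>S f = f * q"
    using mps_principal_ideal_closed jordan_semisimple_part_mod_order_ideal[OF assms] by blast
  then have S: "logarithmic_for f \<delta>S"
    by (auto simp: logarithmic_for_def mps_ideal.span_singleton mult.commute)
  have J: "singular_derivation \<delta>S" "singular_derivation \<delta>N" "\<delta> f = \<delta>S f + \<delta>N f"
    using assms(3) by (auto simp: jordan_decomposition_def)
  then have "\<delta>N f = \<delta> f - \<delta>S f" by simp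
  then have "logarithmic_for f \<delta>N"
    using assms(2) S by (simp add: logarithmic_for_def mps_ideal.span_diff)
  with S J show ?thesis by blast
qed

end
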